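(* Let $\mathbb{P}$ be an $\omega$-poset and let $X\subseteq\mathsf{S}\mathbb{P}$ be a connected subset of its spectrum. Then $C\cap\bigcup X$ is a cluster, for every cap $C$ of $\mathbb{P}$.
   Context: Let $(\mathbb{P},\leq)$ be a poset. A subset $S\subseteq\mathbb{P}$ refines $T\subseteq\mathbb{P}$ if for every $s\in S$ there is $t\in T$ with $s\leq t$. A band of $\mathbb{P}$ is a finite subset $B\subseteq\mathbb{P}$ such that every $p\in\mathbb{P}$ is comparable to some $b\in B$. A cap of $\mathbb{P}$ is a subset refined by some band. A selector is a subset $S\subseteq\mathbb{P}$ with $S\cap C\neq\emptyset$ for every cap $C$ of $\mathbb{P}$; a minimal selector is one minimal with respect to inclusion among all selectors. The spectrum $\mathsf{S}\mathbb{P}$ is the set of all minimal selectors, with the topology generated by the subbasis consisting of the sets $p^\in=\{S\in\mathsf{S}\mathbb{P}:p\in S\}$, for $p\in\mathbb{P}$. $\mathbb{P}$ is an $\omega$-poset if every principal filter $p^\leq=\{q\in\mathbb{P}:p\leq q\}$ is finite and, for each $n\in\omega$, the number of principal filters of size $n$ is finite. For $p,q\in\mathbb{P}$ write $p\wedge q$ if there is $r\in\mathbb{P}$ with $r\leq p$ and $r\leq q$; for $A,B\subseteq\mathbb{P}$ write $A\wedge B$ if $a\wedge b$ for some $a\in A$ and $b\in B$. A subset $D\subseteq\mathbb{P}$ is a cluster if $A\wedge B$ whenever $A\neq\emptyset\neq B$ and $A\cup B=D$ (i.e. $D$ is connected as a subset of the graph on $\mathbb{P}$ with edge relation $\wedge$).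 *)

theory Defs
  imports "HOL-Analysis.Analysis"
begin

text \<open>
  A poset is a carrier set \<open>P\<close> (possibly empty) together with a relation \<open>r\<close> such that
  \<open>partial_order_on P r\<close>, where \<open>(p, q) \<in> r\<close> means $p \leq q$.
\<close>

definition principal_filter :: "'a set \<Rightarrow> 'a rel \<Rightarrow> 'a \<Rightarrow> 'a set" where
  "principal_filter P r p = {q \<in> P. (p, q) \<in> r}"

text \<open>The second clause counts the filters as sets; by antisymmetry this is the same as counting
  the elements generating them.\<close>

definition omega_poset :: "'a set \<Rightarrow> 'a rel \<Rightarrow> bool" where
  "omega_poset P r \<longleftrightarrow>
     partial_order_on P r \<and>
     (\<forall>p\<in>P. finite (principal_filter P r p)) \<and>
     (\<forall>n::nat. finite {F \<in> principal_filter P r ` P. card F = n})"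

definition set_refines :: "'a rel \<Rightarrow> 'a set \<Rightarrow> 'a set \<Rightarrow> bool" where
  "set_refines r S T \<longleftrightarrow> (\<forall>s\<in>S. \<exists>t\<in>T. (s, t) \<in> r)"

definition band :: "'a set \<Rightarrow> 'a rel \<Rightarrow> 'a set \<Rightarrow> bool" where
  "band P r B \<longleftrightarrow>
     B \<subseteq> P \<and> finite B \<and> (\<forall>p\<in>P. \<exists>b\<in>B. (p, b) \<in> r \<or> (b, p) \<in> r)"

definition cap :: "'a set \<Rightarrow> 'a rel \<Rightarrow> 'a set \<Rightarrow> bool" where
  "cap P r C \<longleftrightarrow> C \<subseteq> P \<and> (\<exists>B. band P r B \<and> set_refines r B C)"

definition selector :: "'a set \<Rightarrow> 'a rel \<Rightarrow> 'a set \<Rightarrow> bool" where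
  "selector P r S \<longleftrightarrow> S \<subseteq> P \<and> (\<forall>C. cap P r C \<longrightarrow> S \<inter> C \<noteq> {})"

definition minimal_selector :: "'a set \<Rightarrow> 'a rel \<Rightarrow> 'a set \<Rightarrow> bool" where
  "minimal_selector P r S \<longleftrightarrow>
     selector P r S \<and> (\<forall>S'. selector P r S' \<and> S' \<subseteq> S \<longrightarrow> S' = S)"

definition spectrum :: "'a set \<Rightarrow> 'a rel \<Rightarrow> 'a set set" where
  "spectrum P r = {S. minimal_selector P r S}"

definition subbasic_open :: "'a set \<Rightarrow> 'a rel \<Rightarrow> 'a \<Rightarrow> 'a set set" where
  "subbasic_open P r p = {S \<in> spectrum P r. p \<in> S}"

text \<open>The carrier of \<^term>\<open>topology_generated_by \<S>\<close> is \<open>\<Union>\<S>\<close>, so the whole spectrum (the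
  intersection of no subbasic sets) is added to the generating family explicitly.\<close>

definition spectrum_topology :: "'a set \<Rightarrow> 'a rel \<Rightarrow> 'a set topology" where
  "spectrum_topology P r =
     topology_generated_by (insert (spectrum P r) (subbasic_open P r ` P))"

lemma topspace_spectrum_topology [simp]:
  "topspace (spectrum_topology P r) = spectrum P r"
  by (auto simp: spectrum_topology_def subbasic_open_def)

definition meets :: "'a set \<Rightarrow> 'a rel \<Rightarrow> 'a \<Rightarrow> 'a \<Rightarrow> bool" where
  "meets P r p q \<longleftrightarrow> (\<exists>s\<in>P. (s, p) \<in> r \<and> (s, q) \<in> r)"

definition set_meets :: "'a set \<Rightarrow> 'a rel \<Rightarrow> 'a set \<Rightarrow> 'a set \<Rightarrow> bool" where
  "set_meets P r A B \<longleftrightarrow> (\<exists>a\<in>A. \<exists>b\<in>B. meets P r a b)"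

definition cluster :: "'a set \<Rightarrow> 'a rel \<Rightarrow> 'a set \<Rightarrow> bool" where
  "cluster P r D \<longleftrightarrow>
     D \<subseteq> P \<and> (\<forall>A B. A \<noteq> {} \<and> B \<noteq> {} \<and> A \<union> B = D \<longrightarrow> set_meets P r A B)"

end

theory Submission
  imports Defs
begin

text \<open>
  Suppose \<open>A\<close> and \<open>B\<close> are nonempty with union \<open>C \<inter> \<Union>X\<close>. Every \<open>S \<in> X\<close> is a selector, so it meets
  the cap \<open>C\<close>, and it does so inside \<open>A \<union> B\<close>. Hence the open sets
  \<open>\<Union>a\<in>A. {S. a \<in> S}\<close> and \<open>\<Union>b\<in>B. {S. b \<in> S}\<close> of the spectrum cover \<open>X\<close>, and each of them meets
  \<open>X\<close>. Connectedness puts some \<open>S \<in> X\<close> in both, so \<open>S\<close> contains some \<open>a \<in> A\<close> and some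
  \<open>b \<in> B\<close>. It remains to see that any two elements of a minimal selector have a common lower bound.

  By minimality there are caps \<open>C\<close> and \<open>D\<close> which \<open>S\<close> meets only in \<open>a\<close> and only in \<open>b\<close>,
  respectively (lemma \<open>minimal_selector_isolating_cap\<close>). In an \<open>\<omega>\<close>-poset these have a common
  refinement that is again a cap (lemma \<open>omega_poset_common_refinement\<close>). The selector \<open>S\<close> contains
  an element \<open>e\<close> of that refinement; it lies below some \<open>c \<in> C\<close> and some \<open>d \<in> D\<close>, and since \<open>S\<close>
  is closed upwards (lemma \<open>minimal_selector_upward_closed\<close>) both belong to \<open>S\<close>. So \<open>c = a\<close> and
  \<open>d = b\<close>, and \<open>e\<close> is a common lower bound.

  The \<open>\<omega>\<close>-poset hypothesis serves to make the common refinement a band. Let \<open>F\<close> be the (finite) set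
  of elements above some member of two given bands. Take the minimal elements of \<open>F\<close> together
  with the maximal elements of its complement in \<open>P\<close>: every element of \<open>P\<close> is comparable to one of
  these, and the resulting band refines both of the given ones. There are only finitely many of the
  second kind because their principal filters have at most \<open>card F + 1\<close> elements.
\<close>

section \<open>Finiteness in omega-posets\<close>

lemma poset_refl: "partial_order_on P r \<Longrightarrow> p \<in> P \<Longrightarrow> (p, p) \<in> r"
  by (auto simp: partial_order_on_def preorder_on_def refl_on_def)

lemma poset_antisym: "partial_order_on P r \<Longrightarrow> (p, q) \<in> r \<Longrightarrow> (q, p) \<in> r \<Longrightarrow> p = q"
  by (auto simp: partial_order_on_def antisym_def)

lemma poset_trans: "partial_order_on P r \<Longrightarrow> (p, q) \<in> r \<Longrightarrow> (q, s) \<in> r \<Longrightarrow> (p, s) \<in> r"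
  by (auto simp: partial_order_on_def preorder_on_def dest: transD)

lemma finite_poset_minimal_below:
  assumes "partial_order_on P r" "finite F" "x \<in> F" "x \<in> P"
  obtains m where "m \<in> F" "(m, x) \<in> r" "\<And>y. y \<in> F \<Longrightarrow> (y, m) \<in> r \<Longrightarrow> y = m"
proof -
  let ?A = "{y \<in> F. (y, x) \<in> r}" and ?R = "\<lambda>y z. (y, z) \<in> r \<and> y \<noteq> z"
  have "asymp_on ?A ?R" "transp_on ?A ?R"
    using assms(1) by (auto intro!: asymp_onI transp_onI dest: poset_antisym poset_trans)
  moreover have "x \<in> ?A" using assms by (simp add: poset_refl)
  moreover have "finite ?A" using assms(2) by simp
  ultimately obtain m where "m \<in> ?A" "\<forall>y\<in>?A. y \<noteq> m \<longrightarrow> \<not> ?R y m"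
    using Finite_Set.bex_min_element[of ?A ?R] by blast
  then show thesis using that[of m] poset_trans[OF assms(1)] by blast
qed

lemma poset_maximal_above:
  assumes "partial_order_on P r" "finite (principal_filter P r x)" "x \<in> G" "G \<subseteq> P"
  obtains m where "m \<in> G" "(x, m) \<in> r" "\<And>y. y \<in> G \<Longrightarrow> (m, y) \<in> r \<Longrightarrow> y = m"
proof -
  let ?A = "principal_filter P r x \<inter> G" and ?R = "\<lambda>y z. (y, z) \<in> r \<and> y \<noteq> z"
  have "asymp_on ?A ?R" "transp_on ?A ?R"
    using assms(1) by (auto intro!: asymp_onI transp_onI dest: poset_antisym poset_trans)
  moreover have "x \<in> ?A" using assms by (auto simp: poset_refl principal_filter_def)
  moreover have "finite ?A" using assms(2) by simp
  ultimately obtain m where m: "m \<in> ?A" "\<forall>y\<in>?A. y \<noteq> m \<longrightarrow> \<not> ?R m y"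
    using Finite_Set.bex_max_element[of ?A ?R] by blast
  show thesis
  proof (rule that[of m])
    show "m \<in> G" "(x, m) \<in> r" using m(1) by (auto simp: principal_filter_def)
    fix y assume "y \<in> G" "(m, y) \<in> r"
    moreover from this have "y \<in> ?A"
      using m(1) assms(4) poset_trans[OF assms(1)] by (auto simp: principal_filter_def)
    ultimately show "y = m" using m(2) by auto
  qed
qed

lemma principal_filter_inj_on:
  assumes "partial_order_on P r"
  shows "inj_on (principal_filter P r) P"
proof (rule inj_onI)
  fix p q assume "p \<in> P" "q \<in> P" and eq: "principal_filter P r p = principal_filter P r q"
  then have "p \<in> principal_filter P r q" "q \<in> principal_filter P r p"
    using poset_refl[OF assms] unfolding principal_filter_def by blast+
  then show "p = q" using poset_antisym[OF assms] by (simp add: principal_filter_def)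
qed

lemma omega_poset_finite_bounded_filter:
  assumes "omega_poset P r"
  shows "finite {p \<in> P. card (principal_filter P r p) \<le> n}" (is "finite ?A")
proof (rule finite_imageD)
  have "principal_filter P r ` ?A = (\<Union>k\<le>n. {F \<in> principal_filter P r ` P. card F = k})"
    by auto
  then show "finite (principal_filter P r ` ?A)"
    using assms by (simp add: omega_poset_def)
  show "inj_on (principal_filter P r) ?A"
    using principal_filter_inj_on[of P r] assms
    by (auto simp: omega_poset_def intro: inj_on_subset)
qed

section \<open>Common refinements of caps\<close>

text \<open>
  The upper set generated by \<open>B\<close> is bounded below by its minimal elements, while every element outside it
  is below a maximal such element. A member of a band inside the upper set can lie neither below
  an element outside nor strictly below a minimal one, so comparability turns into refinement.
\<close>

lemma omega_poset_band_refining: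
  assumes "omega_poset P r" "finite B" "B \<subseteq> P"
  obtains M where "band P r M" "\<And>B'. band P r B' \<Longrightarrow> B' \<subseteq> B \<Longrightarrow> set_refines r M B'"
proof -
  have po: "partial_order_on P r" and fin: "\<And>p. p \<in> P \<Longrightarrow> finite (principal_filter P r p)"
    using assms(1) by (auto simp: omega_poset_def)
  define F where "F = (\<Union>b\<in>B. principal_filter P r b)"
  have finF: "finite F" using assms(2,3) fin by (auto simp: F_def)
  have FP: "F \<subseteq> P" by (auto simp: F_def principal_filter_def)
  have BF: "B \<subseteq> F" using assms(3) poset_refl[OF po] by (auto simp: F_def principal_filter_def)
  have up: "q \<in> F" if "p \<in> F" "(p, q) \<in> r" "q \<in> P" for p q
    using that poset_trans[OF po] by (auto simp: F_def principal_filter_def)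
  define M1 where "M1 = {m \<in> F. \<forall>y\<in>F. (y, m) \<in> r \<longrightarrow> y = m}"
  define M2 where "M2 = {m \<in> P - F. \<forall>y\<in>P - F. (m, y) \<in> r \<longrightarrow> y = m}"
  have "M2 \<subseteq> {p \<in> P. card (principal_filter P r p) \<le> Suc (card F)}"
  proof
    fix m assume m: "m \<in> M2"
    then have "principal_filter P r m \<subseteq> insert m F" by (auto simp: M2_def principal_filter_def)
    then have "card (principal_filter P r m) \<le> card (insert m F)"
      using finF by (intro card_mono) auto
    also have "\<dots> \<le> Suc (card F)" by (rule card_insert_le_m1) auto
    finally show "m \<in> {p \<in> P. card (principal_filter P r p) \<le> Suc (card F)}"
      using m by (simp add: M2_def)
  qed
  then have finM2: "finite M2"
    using omega_poset_finite_bounded_filter[OF assms(1)] finite_subset by blast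
  have cmp: "\<exists>m\<in>M1 \<union> M2. (p, m) \<in> r \<or> (m, p) \<in> r" if p: "p \<in> P" for p
  proof (cases "p \<in> F")
    case True
    then obtain m where "m \<in> F" "(m, p) \<in> r" "\<And>y. y \<in> F \<Longrightarrow> (y, m) \<in> r \<Longrightarrow> y = m"
      using finite_poset_minimal_below[OF po finF True p] by blast
    then show ?thesis by (auto simp: M1_def)
  next
    case False
    then have "p \<in> P - F" using p by simp
    then obtain m where "m \<in> P - F" "(p, m) \<in> r" "\<And>y. y \<in> P - F \<Longrightarrow> (m, y) \<in> r \<Longrightarrow> y = m"
      using poset_maximal_above[OF po fin[OF p] _ Diff_subset] by blast
    then show ?thesis by (auto simp: M2_def)
  qed
  show thesis
  proof (rule that[of "M1 \<union> M2"])
    show "band P r (M1 \<union> M2)"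
      using cmp finM2 finF FP by (auto simp: band_def M1_def M2_def)
    fix B' assume B': "band P r B'" "B' \<subseteq> B"
    show "set_refines r (M1 \<union> M2) B'"
      unfolding set_refines_def
    proof
      fix m assume m: "m \<in> M1 \<union> M2"
      then have "m \<in> P" using FP by (auto simp: M1_def M2_def)
      then obtain b where b: "b \<in> B'" "(m, b) \<in> r \<or> (b, m) \<in> r"
        using B'(1) by (auto simp: band_def)
      have "(m, b) \<in> r" if "(b, m) \<in> r"
      proof -
        have "b \<in> F" using b(1) B'(2) BF by auto
        then have "m \<in> F" using up that \<open>m \<in> P\<close> by blast
        then have "b = m" using m \<open>b \<in> F\<close> that by (auto simp: M1_def M2_def)
        then show ?thesis using that by simp
      qed
      then show "\<exists>t\<in>B'. (m, t) \<in> r" using b by blast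
    qed
  qed
qed

lemma set_refines_trans:
  assumes "partial_order_on P r" "set_refines r A B" "set_refines r B C"
  shows "set_refines r A C"
  using assms(2,3) poset_trans[OF assms(1)] unfolding set_refines_def by meson

lemma omega_poset_common_refinement:
  assumes "omega_poset P r" "cap P r C" "cap P r D"
  obtains E where "cap P r E" "set_refines r E C" "set_refines r E D"
proof -
  have po: "partial_order_on P r" using assms(1) by (simp add: omega_poset_def)
  obtain B1 B2 where B: "band P r B1" "set_refines r B1 C" "band P r B2" "set_refines r B2 D"
    using assms(2,3) by (auto simp: cap_def)
  obtain M where M: "band P r M" "set_refines r M B1" "set_refines r M B2"
  proof (rule omega_poset_band_refining[OF assms(1), of "B1 \<union> B2"])
    show "finite (B1 \<union> B2)" "B1 \<union> B2 \<subseteq> P" using B(1,3) by (auto simp: band_def)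
  qed (use B(1,3) in auto)
  have "M \<subseteq> P" using M(1) by (simp add: band_def)
  then have "cap P r M"
    using M(1) poset_refl[OF po] by (auto simp: cap_def set_refines_def)
  then show thesis using that M B set_refines_trans[OF po] by blast
qed

section \<open>Minimal selectors\<close>

lemma minimal_selector_meets_cap:
  "minimal_selector P r S \<Longrightarrow> cap P r C \<Longrightarrow> S \<inter> C \<noteq> {}"
  unfolding minimal_selector_def selector_def by blast

lemma minimal_selector_isolating_cap:
  assumes "minimal_selector P r S" "a \<in> S"
  obtains C where "cap P r C" "S \<inter> C = {a}"
proof -
  have S: "selector P r S" and "\<not> selector P r (S - {a})"
    using assms unfolding minimal_selector_def by blast+
  then obtain C where C: "cap P r C" "(S - {a}) \<inter> C = {}"
    unfolding selector_def by blast
  moreover have "S \<inter> C \<noteq> {}" using S C(1) by (simp add: selector_def)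
  ultimately show thesis using that by blast
qed

text \<open>
  Replacing \<open>s\<close> by a larger \<open>t\<close> in a cap that \<open>S\<close> meets only in \<open>s\<close> gives another cap, and \<open>t\<close> is
  the only point where \<open>S\<close> can meet it.
\<close>

lemma minimal_selector_upward_closed:
  assumes po: "partial_order_on P r"
    and S: "minimal_selector P r S" and s: "s \<in> S" and t: "t \<in> P" "(s, t) \<in> r"
  shows "t \<in> S"
proof -
  obtain C where C: "cap P r C" "S \<inter> C = {s}"
    using minimal_selector_isolating_cap[OF S s] .
  let ?C' = "insert t (C - {s})"
  have "C \<subseteq> P" using C(1) by (simp add: cap_def)
  then have "set_refines r C ?C'"
    using t poset_refl[OF po] by (auto simp: set_refines_def)
  then have "cap P r ?C'"
    using C(1) t(1) \<open>C \<subseteq> P\<close> set_refines_trans[OF po] unfolding cap_def by blast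
  then have "S \<inter> ?C' \<noteq> {}" by (rule minimal_selector_meets_cap[OF S])
  then show "t \<in> S" using C(2) by blast
qed

lemma minimal_selector_elements_meet:
  assumes om: "omega_poset P r" and S: "minimal_selector P r S" and ab: "a \<in> S" "b \<in> S"
  shows "meets P r a b"
proof -
  have po: "partial_order_on P r" using om by (simp add: omega_poset_def)
  obtain C where C: "cap P r C" "S \<inter> C = {a}"
    using minimal_selector_isolating_cap[OF S ab(1)] .
  obtain D where D: "cap P r D" "S \<inter> D = {b}"
    using minimal_selector_isolating_cap[OF S ab(2)] .
  obtain E where E: "cap P r E" "set_refines r E C" "set_refines r E D"
    using omega_poset_common_refinement[OF om C(1) D(1)] .
  obtain e where e: "e \<in> S" "e \<in> E"
    using minimal_selector_meets_cap[OF S E(1)] by blast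
  have below: "(e, x) \<in> r" if K: "set_refines r E K" "cap P r K" "S \<inter> K = {x}" for K x
  proof -
    obtain k where k: "k \<in> K" "(e, k) \<in> r"
      using K(1) e(2) by (auto simp: set_refines_def)
    moreover have "k \<in> P" using k(1) K(2) by (auto simp: cap_def)
    ultimately have "k \<in> S" using minimal_selector_upward_closed[OF po S e(1)] by blast
    then have "k \<in> {x}" using k(1) K(3) by blast
    then show ?thesis using k(2) by simp
  qed
  have "e \<in> P" using e(2) E(1) by (auto simp: cap_def)
  then show ?thesis using below[OF E(2) C] below[OF E(3) D] by (auto simp: meets_def)
qed

section \<open>Connected subsets of the spectrum\<close>

lemma openin_spectrum_containing:
  assumes "A \<subseteq> P"
  shows "openin (spectrum_topology P r) (\<Union>a\<in>A. subbasic_open P r a)"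
  unfolding spectrum_topology_def
  using assms by (intro openin_Union) (auto intro: topology_generated_by_Basis)

theorem proposition2p48:
  fixes P :: "'a set" and r :: "'a rel" and X :: "'a set set"
  assumes "omega_poset P r"
    and "X \<subseteq> spectrum P r"
    and "connectedin (spectrum_topology P r) X"
  shows "\<forall>C. cap P r C \<longrightarrow> cluster P r (C \<inter> \<Union>X)"
proof (intro allI impI)
  fix C assume C: "cap P r C"
  then have CP: "C \<subseteq> P" by (simp add: cap_def)
  have min: "minimal_selector P r S" if "S \<in> X" for S
    using that assms(2) by (auto simp: spectrum_def)
  have "set_meets P r A B" if AB: "A \<noteq> {}" "B \<noteq> {}" "A \<union> B = C \<inter> \<Union>X" for A B
  proof -
    let ?U = "\<lambda>A. \<Union>a\<in>A. subbasic_open P r a"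
    have in_U: "S \<in> ?U K \<longleftrightarrow> S \<inter> K \<noteq> {}" if "S \<in> X" for S K
      using that assms(2) by (auto simp: subbasic_open_def)
    have "A \<subseteq> P" "B \<subseteq> P" using AB(3) CP by auto
    then have op: "openin (spectrum_topology P r) (?U A)" "openin (spectrum_topology P r) (?U B)"
      by (simp_all add: openin_spectrum_containing)
    have cover: "X \<subseteq> ?U A \<union> ?U B"
    proof
      fix S assume S: "S \<in> X"
      then have "S \<inter> C \<noteq> {}" using minimal_selector_meets_cap[OF min C] by blast
      then have "S \<inter> A \<noteq> {} \<or> S \<inter> B \<noteq> {}" using S AB(3) by blast
      then show "S \<in> ?U A \<union> ?U B" using in_U[OF S] by blast
    qed
    have "?U K \<inter> X \<noteq> {}" if K: "K \<noteq> {}" "K \<subseteq> \<Union>X" for K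
    proof -
      obtain x S where "x \<in> K" "S \<in> X" "x \<in> S" using K by blast
      then show ?thesis using in_U[of S K] by blast
    qed
    moreover have "A \<subseteq> \<Union>X" "B \<subseteq> \<Union>X" using AB(3) by auto
    ultimately have "?U A \<inter> X \<noteq> {}" "?U B \<inter> X \<noteq> {}" using AB(1,2) by blast+
    then have "?U A \<inter> ?U B \<inter> X \<noteq> {}"
      using assms(3) op cover unfolding connectedin by blast
    then obtain S where S: "S \<in> X" "S \<in> ?U A" "S \<in> ?U B" by blast
    then obtain a b where "a \<in> A" "b \<in> B" "a \<in> S" "b \<in> S" using in_U[OF S(1)] by blast
    then show ?thesis
      using minimal_selector_elements_meet[OF assms(1) min[OF S(1)]] by (auto simp: set_meets_def)
  qed
  then show "cluster P r (C \<inter> \<Union>X)" using CP by (auto simp: cluster_def)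
qed

end
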